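(* The closed form formula of the $k$-Mersenne-Lucas octonions $m\mathbb{O}_{k,n}$ is $$m\mathbb{O}_{k,n}=\alpha\lambda_1^{n}+\beta\lambda_2^{n},$$ where $\alpha=\sum_{r=0}^{7}\lambda_1^{r}e_r$ and $\beta=\sum_{r=0}^{7}\lambda_2^{r}e_r$.
   Context: $\mathbb{O}$ denotes the octonions, the $8$-dimensional real algebra with basis $e_0=1,e_1,\dots,e_7$ (only its vector space structure is needed here). For a parameter $k$, the $k$-Mersenne-Lucas numbers are defined by $m_{k,0}=2$, $m_{k,1}=3k$, $m_{k,n+1}=3km_{k,n}-2m_{k,n-1}$ for $n\ge1$. The $n$-th $k$-Mersenne-Lucas octonion is $m\mathbb{O}_{k,n}=\sum_{r=0}^{7}m_{k,n+r}e_r$ for $n\ge 0$. The numbers $\lambda_1=\frac{3k+\sqrt{9k^2-8}}{2}$ and $\lambda_2=\frac{3k-\sqrt{9k^2-8}}{2}$ are the roots of $\lambda^2-3k\lambda+2=0$. *)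

theory Defs
  imports "HOL-Analysis.Analysis"
begin

(* The coordinate space of the octonions in the basis e_0, ..., e_7.  Only the
   vector space structure matters here, so no product is defined.
   "real octonions" is the 8-dimensional real vector space underlying the
   octonion algebra; "complex octonions" is its complexification, needed because
   the roots lambda1, lambda2 are not real when 9 k^2 < 8. *)
type_synonym 'a octonions = "'a ^ 8"

(* Pitfall: the octonion unit is oct_basis 0, not the library's all-ones vector 1.
   The index type 8 has the elements of_nat 0, ..., of_nat 7. *)
definition oct_basis :: "nat \<Rightarrow> ('a::comm_ring_1) octonions" where
  "oct_basis r = axis (of_nat r) 1"

fun mersenne_lucas :: "'a::comm_ring_1 \<Rightarrow> nat \<Rightarrow> 'a" where
  "mersenne_lucas k 0 = 2"
| "mersenne_lucas k (Suc 0) = 3 * k"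
| "mersenne_lucas k (Suc (Suc n)) = 3 * k * mersenne_lucas k (Suc n) - 2 * mersenne_lucas k n"

definition mersenne_lucas_oct :: "'a::comm_ring_1 \<Rightarrow> nat \<Rightarrow> 'a octonions" where
  "mersenne_lucas_oct k n = (\<Sum>r = 0..7. mersenne_lucas k (n + r) *s oct_basis r)"

(* alpha = power_oct lambda1 and beta = power_oct lambda2 *)
definition power_oct :: "'a::comm_ring_1 \<Rightarrow> 'a octonions" where
  "power_oct l = (\<Sum>r = 0..7. l ^ r *s oct_basis r)"

(* The library's real sqrt is odd, so these are the roots of
   x^2 - 3 k x + 2 only if 9 k^2 >= 8. *)
definition lambda1 :: "real \<Rightarrow> real" where
  "lambda1 k = (3 * k + sqrt (9 * k\<^sup>2 - 8)) / 2"

definition lambda2 :: "real \<Rightarrow> real" where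
  "lambda2 k = (3 * k - sqrt (9 * k\<^sup>2 - 8)) / 2"

definition clambda1 :: "complex \<Rightarrow> complex" where
  "clambda1 k = (3 * k + csqrt (9 * k\<^sup>2 - 8)) / 2"

definition clambda2 :: "complex \<Rightarrow> complex" where
  "clambda2 k = (3 * k - csqrt (9 * k\<^sup>2 - 8)) / 2"

end

theory Submission
  imports Defs
begin

text \<open>The recurrence has characteristic polynomial \<open>x\<^sup>2 - 3 k x + 2\<close>, so the powers of its two
  roots satisfy it.  The initial values 2 and \<open>3 k\<close> are the zeroth and first power sums of the
  roots, hence every term is the power sum \<open>a ^ n + b ^ n\<close>.  Since \<open>a ^ (n + r) = a ^ n * a ^ r\<close>,
  the factor \<open>a ^ n\<close> can be taken out of all eight coordinates at once, and the closed form for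
  numbers becomes one for octonions.  The argument uses the roots only through
  \<open>a + b = 3 k\<close> and \<open>a * b = 2\<close>, so it works over any commutative ring and covers real and
  complex roots, distinct or not, alike.\<close>

lemma mersenne_lucas_eq_power_sum:
  fixes a b k :: "'a::comm_ring_1"
  assumes sum: "a + b = 3 * k" and prod: "a * b = 2"
  shows "mersenne_lucas k n = a ^ n + b ^ n"
proof (induction n rule: induct_nat_012)
  case (ge2 n)
  have "mersenne_lucas k (Suc (Suc n))
      = (a + b) * (a ^ Suc n + b ^ Suc n) - (a * b) * (a ^ n + b ^ n)"
    using ge2 by (simp add: sum prod)
  also have "\<dots> = a ^ Suc (Suc n) + b ^ Suc (Suc n)"
    by (simp add: algebra_simps)
  finally show ?case .
qed (use sum in simp_all)

lemma mersenne_lucas_oct_eq_power_oct: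
  fixes a b k :: "'a::comm_ring_1"
  assumes "a + b = 3 * k" and "a * b = 2"
  shows "mersenne_lucas_oct k n = a ^ n *s power_oct a + b ^ n *s power_oct b"
  unfolding mersenne_lucas_oct_def power_oct_def mersenne_lucas_eq_power_sum[OF assms]
  by (simp add: vec_eq_iff sum_distrib_left power_add algebra_simps flip: sum.distrib)

lemma lambda_sum: "lambda1 k + lambda2 k = 3 * k"
  by (simp add: lambda1_def lambda2_def field_simps)

lemma lambda_prod:
  assumes "9 * k\<^sup>2 \<ge> 8"
  shows "lambda1 k * lambda2 k = 2"
proof -
  have "lambda1 k * lambda2 k = ((3 * k)\<^sup>2 - (sqrt (9 * k\<^sup>2 - 8))\<^sup>2) / 4"
    by (simp add: lambda1_def lambda2_def field_simps power2_eq_square)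
  then show ?thesis
    using assms by (simp add: power_mult_distrib)
qed

lemma clambda_sum: "clambda1 k + clambda2 k = 3 * k"
  by (simp add: clambda1_def clambda2_def field_simps)

lemma clambda_prod: "clambda1 k * clambda2 k = 2"
proof -
  have "clambda1 k * clambda2 k = ((3 * k)\<^sup>2 - (csqrt (9 * k\<^sup>2 - 8))\<^sup>2) / 4"
    unfolding clambda1_def clambda2_def by (simp add: field_simps power2_eq_square)
  then show ?thesis
    by (simp add: power_mult_distrib)
qed

theorem theorem3p2:
  fixes k :: real and n :: nat
  shows "(9 * k\<^sup>2 \<ge> 8 \<longrightarrow>
           mersenne_lucas_oct k n
             = lambda1 k ^ n *s power_oct (lambda1 k) + lambda2 k ^ n *s power_oct (lambda2 k))
       \<and> mersenne_lucas_oct (complex_of_real k) n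
           = clambda1 (complex_of_real k) ^ n *s power_oct (clambda1 (complex_of_real k))
             + clambda2 (complex_of_real k) ^ n *s power_oct (clambda2 (complex_of_real k))"
  using mersenne_lucas_oct_eq_power_oct[OF lambda_sum lambda_prod]
    mersenne_lucas_oct_eq_power_oct[OF clambda_sum clambda_prod]
  by blast

end
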